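(* There exists a sufficiently large, yet finite, penalty parameter $\rho>0$ such that the second-stage loss function $$\mathcal{Q}(\bm{x},\bm{\xi})=\inf_{\bm{y}\in\mathcal{Y}}\left\{\bm{q}(\bm{\xi})^\top\bm{y} : \bm{W}_0\bm{y}\geq\bm{T}_0\bm{\xi}+\bm{h}(\bm{x})\right\}$$ is equal, for all $\bm{x}\in\mathcal{X}$ and $\bm{\xi}\in\Xi$, to $$\mathcal{Q}^\rho(\bm{x},\bm{\xi}) := \inf_{\bm{y}\in\mathcal{Y},\,\bm{z}\in[0,1]^M}\left\{\bm{q}(\bm{\xi})^\top\bm{y} + \rho\left((\mathbf{e}-2\bm{\xi})^\top\bm{z} + \mathbf{e}^\top\bm{\xi}\right) : \bm{W}_0\bm{y}\geq\bm{T}_0\bm{z}+\bm{h}(\bm{x})\right\}.$$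
   Context: $\Xi\subseteq\{0,1\}^M$; $\mathcal{X}\subseteq\mathbb{R}^{N_1}$ is convex and compact; $\mathcal{Y}\subseteq\mathbb{R}^{N_2}$ is a proper cone (closed, convex, pointed, full-dimensional); $\bm{q}(\bm{\xi})=\bm{q}_0+\bm{Q}\bm{\xi}$ is affine with $\bm{Q}\in\mathbb{R}^{N_2\times M}$; $\bm{h}:\mathcal{X}\to\mathbb{R}^L$ is componentwise closed, proper, convex; $\mathbf{e}$ is the all-ones vector. Standing assumptions. (A1) For every $\bm{\xi}\in\Xi$ there exists $\bm{y}^+\in\mathrm{int}(\mathcal{Y})$ with $\bm{W}(\bm{\xi})\bm{y}^+>0$ (componentwise), where $\bm{W}(\bm{\xi})$ is the recourse matrix. (A2) For every $\bm{x}\in\mathcal{X}$, $\bm{\xi}\in\Xi$, $\mathcal{Q}(\bm{x},\bm{\xi})$ is bounded (finite). (A3) Fixed recourse: the recourse matrix and the matrix multiplying $\bm{\xi}$ are constant, $\bm{W}(\bm{\xi})=\bm{W}_0\in\mathbb{R}^{L\times N_2}$ for all $\bm{\xi}\in\Xi$ and $\bm{T}(\bm{x})=\bm{T}_0\in\mathbb{R}^{L\times M}$ for all $\bm{x}\in\mathcal{X}$. *)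

theory Defs
  imports "HOL-Analysis.Analysis"
begin

definition proper_cone :: "'a::euclidean_space set \<Rightarrow> bool" where
  "proper_cone Y \<longleftrightarrow> cone Y \<and> closed Y \<and> convex Y
     \<and> (\<forall>y. y \<in> Y \<and> - y \<in> Y \<longrightarrow> y = 0)
     \<and> aff_dim Y = int DIM('a)"

text \<open>A real-valued function on \<open>X\<close> is identified with its extension by \<open>+\<infinity>\<close> outside \<open>X\<close>.
  Its effective domain is \<open>X\<close> and it never takes the value \<open>-\<infinity>\<close>, so properness amounts to
  \<open>X \<noteq> {}\<close>; closedness is closedness of the epigraph.\<close>

definition closed_proper_convex_on :: "'a::euclidean_space set \<Rightarrow> ('a \<Rightarrow> real) \<Rightarrow> bool" where
  "closed_proper_convex_on X f \<longleftrightarrow> closed (epigraph X f) \<and> X \<noteq> {} \<and> convex_on X f"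

text \<open>The order \<open>\<le>\<close> on \<open>real ^ 'l\<close> is the componentwise one. Optimal values are extended reals:
  \<open>\<infinity>\<close> if no decision is feasible and \<open>-\<infinity>\<close> if the objective is unbounded below.\<close>

definition second_stage_loss ::
  "(real ^ 'n2) set \<Rightarrow> (real ^ 'm \<Rightarrow> real ^ 'n2) \<Rightarrow> (real ^ 'm \<Rightarrow> real ^ 'n2 ^ 'l) \<Rightarrow>
   (real ^ 'n1 \<Rightarrow> real ^ 'm ^ 'l) \<Rightarrow> (real ^ 'n1 \<Rightarrow> real ^ 'l) \<Rightarrow>
   real ^ 'n1 \<Rightarrow> real ^ 'm \<Rightarrow> ereal" where
  "second_stage_loss Y q W T h x \<xi> =
     (INF y \<in> {y \<in> Y. W \<xi> *v y \<ge> T x *v \<xi> + h x}. ereal (q \<xi> \<bullet> y))"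

text \<open>Here \<open>1 :: real ^ 'm\<close> is the all-ones vector.\<close>

definition penalized_loss ::
  "(real ^ 'n2) set \<Rightarrow> (real ^ 'm \<Rightarrow> real ^ 'n2) \<Rightarrow> real ^ 'n2 ^ 'l \<Rightarrow> real ^ 'm ^ 'l \<Rightarrow>
   (real ^ 'n1 \<Rightarrow> real ^ 'l) \<Rightarrow> real \<Rightarrow> real ^ 'n1 \<Rightarrow> real ^ 'm \<Rightarrow> ereal" where
  "penalized_loss Y q W0 T0 h \<rho> x \<xi> =
     (INF (y, z) \<in> {(y, z). y \<in> Y \<and> (\<forall>i. z $ i \<in> {0..1}) \<and> W0 *v y \<ge> T0 *v z + h x}.
        ereal (q \<xi> \<bullet> y + \<rho> * ((1 - 2 *\<^sub>R \<xi>) \<bullet> z + 1 \<bullet> \<xi>)))"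

end

theory Submission
  imports Defs
begin

text \<open>For binary \<open>\<xi>\<close> and \<open>z \<in> [0,1]\<^sup>M\<close> the penalty term is the \<open>\<ell>\<^sub>1\<close> distance of \<open>z\<close> and \<open>\<xi>\<close>.
  Hence \<open>z = \<xi>\<close> costs nothing, and the penalized loss is at most the loss. Conversely, let \<open>(y, z)\<close>
  be feasible for the penalized problem and let \<open>y\<^sup>+ \<in> Y\<close> be a Slater direction, \<open>W\<^sub>0 y\<^sup>+ > 0\<close>. Adding
  \<open>C \<parallel>z - \<xi>\<parallel>\<^sub>1 y\<^sup>+\<close> to \<open>y\<close>, with \<open>C\<close> depending only on \<open>T\<^sub>0\<close> and \<open>W\<^sub>0 y\<^sup>+\<close>, gives a feasible point of
  the original problem, and its cost exceeds that of \<open>y\<close> by at most \<open>\<rho> \<parallel>z - \<xi>\<parallel>\<^sub>1\<close> as soon as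
  \<open>\<rho> \<ge> C sup\<^sub>\<xi> q(\<xi>)\<^sup>T y\<^sup>+\<close>, which is finite because \<open>\<Xi>\<close> is bounded.\<close>

lemma binary_penalty_eq_l1_dist:
  fixes z \<xi> :: "real ^ 'm"
  assumes "\<forall>i. \<xi> $ i \<in> {0, 1}" and "\<forall>i. z $ i \<in> {0..1}"
  shows "(1 - 2 *\<^sub>R \<xi>) \<bullet> z + 1 \<bullet> \<xi> = (\<Sum>i\<in>UNIV. \<bar>\<xi> $ i - z $ i\<bar>)"
proof -
  \<comment> \<open>Both sides are \<open>z $ i\<close> if \<open>\<xi> $ i = 0\<close> and
    \<open>1 - z $ i\<close> if \<open>\<xi> $ i = 1\<close>.\<close>
  have "(1 - 2 * \<xi> $ i) * z $ i + \<xi> $ i = \<bar>\<xi> $ i - z $ i\<bar>" for i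
  proof -
    have "\<xi> $ i = 0 \<or> \<xi> $ i = 1" and "0 \<le> z $ i" and "z $ i \<le> 1"
      using assms by auto
    then show ?thesis by auto
  qed
  then show ?thesis
    by (simp add: inner_vec_def flip: sum.distrib)
qed

text \<open>Each entry of \<open>A *v v\<close> is at most the l1 norm of its row times that of
  \<open>v\<close>, and a strictly positive \<open>w\<close> absorbs the row norms after
  scaling.\<close>

lemma matrix_vector_le_l1_scaleR:
  fixes A :: "real ^ 'm ^ 'l" and w :: "real ^ 'l"
  assumes "\<And>i. w $ i > 0"
  shows "\<exists>C\<ge>0. \<forall>v. A *v v \<le> (C * (\<Sum>j\<in>UNIV. \<bar>v $ j\<bar>)) *\<^sub>R w"
proof -
  \<comment> \<open>\<open>c i\<close> is a constant that suffices for row \<open>i\<close>. As all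
    are nonnegative, their sum serves every row at once.\<close>
  define c where "c i = (\<Sum>j\<in>UNIV. \<bar>A $ i $ j\<bar>) / w $ i" for i
  have c: "c i \<ge> 0" for i
    using assms[of i] by (simp add: c_def sum_nonneg)
  have "(A *v v) $ i \<le> (sum c UNIV * (\<Sum>j\<in>UNIV. \<bar>v $ j\<bar>)) * w $ i" for v i
  proof -
    let ?s = "\<Sum>j\<in>UNIV. \<bar>v $ j\<bar>"
    have "(A *v v) $ i \<le> (\<Sum>j\<in>UNIV. \<bar>A $ i $ j\<bar> * ?s)"
      unfolding matrix_vector_mult_def vec_lambda_beta
    proof (rule sum_mono)
      fix j
      have "A $ i $ j * v $ j \<le> \<bar>A $ i $ j\<bar> * \<bar>v $ j\<bar>"
        by (metis abs_ge_self abs_mult)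
      also have "\<dots> \<le> \<bar>A $ i $ j\<bar> * ?s"
        by (intro mult_left_mono member_le_sum) auto
      finally show "A $ i $ j * v $ j \<le> \<bar>A $ i $ j\<bar> * ?s" .
    qed
    also have "\<dots> = c i * (?s * w $ i)"
      using assms[of i] by (simp add: c_def flip: sum_distrib_right)
    also have "\<dots> \<le> sum c UNIV * (?s * w $ i)"
      using assms[of i] c by (intro mult_right_mono member_le_sum mult_nonneg_nonneg sum_nonneg) auto
    finally show ?thesis by (simp add: mult.assoc)
  qed
  moreover have "sum c UNIV \<ge> 0"
    using c by (simp add: sum_nonneg)
  ultimately show ?thesis
    by (intro exI[of _ "sum c UNIV"]) (simp add: less_eq_vec_def)
qed

lemma penalized_loss_le_second_stage_loss:
  fixes \<xi> :: "real ^ 'm"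
  assumes "\<forall>i. \<xi> $ i \<in> {0, 1}"
  shows "penalized_loss Y q W0 T0 h \<rho> x \<xi> \<le> second_stage_loss Y q (\<lambda>_. W0) (\<lambda>_. T0) h x \<xi>"
proof -
  have \<xi>: "\<forall>i. \<xi> $ i \<in> {0..1}"
  proof
    fix i
    show "\<xi> $ i \<in> {0..1}" using assms[rule_format, of i] by auto
  qed
  show ?thesis
    unfolding second_stage_loss_def
  proof (rule INF_greatest)
    fix y assume "y \<in> {y \<in> Y. W0 *v y \<ge> T0 *v \<xi> + h x}"
    then have "penalized_loss Y q W0 T0 h \<rho> x \<xi>
        \<le> ereal (q \<xi> \<bullet> y + \<rho> * ((1 - 2 *\<^sub>R \<xi>) \<bullet> \<xi> + 1 \<bullet> \<xi>))"
      unfolding penalized_loss_def using \<xi> by (intro INF_lower2[of "(y, \<xi>)"]) auto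
    then show "penalized_loss Y q W0 T0 h \<rho> x \<xi> \<le> ereal (q \<xi> \<bullet> y)"
      by (simp add: binary_penalty_eq_l1_dist[OF assms \<xi>])
  qed
qed

text \<open>Premise \<open>C\<close> lets a move along \<open>p\<close> repair the constraint when
  \<open>z\<close> is replaced by \<open>\<xi>\<close>; premise \<open>\<rho>\<close> makes the
  penalty pay for that move.\<close>

lemma second_stage_loss_le_penalized_loss:
  fixes \<xi> :: "real ^ 'm"
  assumes "\<forall>i. \<xi> $ i \<in> {0, 1}"
    and "convex Y" and "cone Y" and "p \<in> Y" and "C \<ge> 0"
    and C: "\<And>v. T0 *v v \<le> (C * (\<Sum>j\<in>UNIV. \<bar>v $ j\<bar>)) *\<^sub>R (W0 *v p)"
    and \<rho>: "C * (q \<xi> \<bullet> p) \<le> \<rho>"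
  shows "second_stage_loss Y q (\<lambda>_. W0) (\<lambda>_. T0) h x \<xi> \<le> penalized_loss Y q W0 T0 h \<rho> x \<xi>"
  unfolding penalized_loss_def
proof (rule INF_greatest, clarify)
  fix y z
  assume y: "y \<in> Y" and z: "\<forall>i. z $ i \<in> {0..1}" and feas: "T0 *v z + h x \<le> W0 *v y"
  define d where "d = (\<Sum>j\<in>UNIV. \<bar>(\<xi> - z) $ j\<bar>)"
  \<comment> \<open>The shift raises \<open>W0 *v y\<close> by
    \<open>(C * d) *\<^sub>R (W0 *v p)\<close>, which covers the possible deficit
    \<open>T0 *v (\<xi> - z)\<close>.\<close>
  define y' where "y' = y + (C * d) *\<^sub>R p"
  have d: "d \<ge> 0"
    by (simp add: d_def sum_nonneg)
  then have "(C * d) *\<^sub>R p \<in> Y"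
    using assms by (simp add: mem_cone)
  then have y': "y' \<in> Y"
    using y assms(2,3) convex_cone[of Y] by (auto simp: y'_def)
  have "T0 *v \<xi> + h x = (T0 *v z + h x) + T0 *v (\<xi> - z)"
    by (simp add: matrix_vector_mult_diff_distrib)
  also have "\<dots> \<le> W0 *v y + (C * d) *\<^sub>R (W0 *v p)"
    using C[of "\<xi> - z"] feas unfolding d_def by (rule add_mono[rotated])
  also have "\<dots> = W0 *v y'"
    by (simp add: y'_def matrix_vector_right_distrib matrix_vector_mult_scaleR)
  finally have "second_stage_loss Y q (\<lambda>_. W0) (\<lambda>_. T0) h x \<xi> \<le> ereal (q \<xi> \<bullet> y')"
    unfolding second_stage_loss_def using y' by (intro INF_lower) auto
  also have "q \<xi> \<bullet> y' \<le> q \<xi> \<bullet> y + \<rho> * d"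
    using mult_right_mono[OF \<rho> d] by (simp add: y'_def inner_add_right ac_simps)
  also have "d = (1 - 2 *\<^sub>R \<xi>) \<bullet> z + 1 \<bullet> \<xi>"
    by (simp add: d_def binary_penalty_eq_l1_dist[OF assms(1) z])
  finally show "second_stage_loss Y q (\<lambda>_. W0) (\<lambda>_. T0) h x \<xi>
      \<le> ereal (q \<xi> \<bullet> y + \<rho> * ((1 - 2 *\<^sub>R \<xi>) \<bullet> z + 1 \<bullet> \<xi>))"
    by simp
qed

theorem theorem3:
  fixes X :: "(real ^ 'n1) set" and Y :: "(real ^ 'n2) set" and \<Xi> :: "(real ^ 'm) set"
    and q :: "real ^ 'm \<Rightarrow> real ^ 'n2" and q0 :: "real ^ 'n2" and Q :: "real ^ 'm ^ 'n2"
    and h :: "real ^ 'n1 \<Rightarrow> real ^ 'l"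
    and W :: "real ^ 'm \<Rightarrow> real ^ 'n2 ^ 'l" and W0 :: "real ^ 'n2 ^ 'l"
    and T :: "real ^ 'n1 \<Rightarrow> real ^ 'm ^ 'l" and T0 :: "real ^ 'm ^ 'l"
  assumes "\<Xi> \<subseteq> {\<xi>. \<forall>i. \<xi> $ i \<in> {0, 1}}"
    and "convex X" and "compact X"
    and "proper_cone Y"
    and "\<And>\<xi>. q \<xi> = q0 + Q *v \<xi>"
    and "\<And>i. closed_proper_convex_on X (\<lambda>x. h x $ i)"
    and A1: "\<And>\<xi>. \<xi> \<in> \<Xi> \<Longrightarrow> \<exists>y \<in> interior Y. \<forall>i. (W \<xi> *v y) $ i > 0"
    and A2: "\<And>x \<xi>. x \<in> X \<Longrightarrow> \<xi> \<in> \<Xi> \<Longrightarrow> \<bar>second_stage_loss Y q W T h x \<xi>\<bar> \<noteq> \<infinity>"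
    and A3: "\<And>\<xi>. \<xi> \<in> \<Xi> \<Longrightarrow> W \<xi> = W0" "\<And>x. x \<in> X \<Longrightarrow> T x = T0"
  shows "\<exists>\<rho>>0. \<forall>x\<in>X. \<forall>\<xi>\<in>\<Xi>.
    second_stage_loss Y q (\<lambda>_. W0) (\<lambda>_. T0) h x \<xi> = penalized_loss Y q W0 T0 h \<rho> x \<xi>"
proof (cases "\<Xi> = {}")
  case True
  then show ?thesis by (intro exI[of _ 1]) simp
next
  case False
  have bin: "\<forall>i. \<xi> $ i \<in> {0, 1}" if "\<xi> \<in> \<Xi>" for \<xi>
    using that assms(1) by blast
  \<comment> \<open>With fixed recourse, the Slater point of a single scenario serves all of them,
    so \<open>p\<close> and \<open>C\<close> do not depend on \<open>\<xi>\<close>.\<close>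
  obtain p where "p \<in> interior Y" and Wp: "\<And>i. (W0 *v p) $ i > 0"
    using False A1 A3(1) by (metis ex_in_conv)
  then have p: "p \<in> Y"
    using interior_subset by blast
  obtain C where C0: "C \<ge> 0"
    and C: "\<And>v. T0 *v v \<le> (C * (\<Sum>j\<in>UNIV. \<bar>v $ j\<bar>)) *\<^sub>R (W0 *v p)"
    using matrix_vector_le_l1_scaleR[of "W0 *v p" T0] Wp by blast
  have "\<Xi> \<subseteq> cbox 0 1"
  proof
    fix \<xi> assume "\<xi> \<in> \<Xi>"
    then have "\<xi> $ i = 0 \<or> \<xi> $ i = 1" for i
      using bin by blast
    then show "\<xi> \<in> cbox 0 1"
      by (metis mem_box_cart(2) one_index order_refl zero_index zero_le_one)
  qed
  then have "bounded ((*v) Q ` \<Xi>)"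
    by (meson bounded_cbox bounded_subset bounded_linear_image matrix_vector_mul_bounded_linear)
  then obtain B where B: "\<And>\<xi>. \<xi> \<in> \<Xi> \<Longrightarrow> norm (Q *v \<xi>) \<le> B"
    unfolding bounded_iff by blast
  \<comment> \<open>Cauchy-Schwarz bounds \<open>q \<xi> \<bullet> p\<close> uniformly over
    \<open>\<Xi>\<close>; the added 1 keeps \<open>\<rho>\<close> positive even when
    \<open>C = 0\<close>.\<close>
  define \<rho> where "\<rho> = C * ((norm q0 + B) * norm p) + 1"
  have le: "C * (q \<xi> \<bullet> p) \<le> \<rho>" if "\<xi> \<in> \<Xi>" for \<xi>
  proof -
    have "q \<xi> \<bullet> p \<le> norm (q \<xi>) * norm p"
      by (rule norm_cauchy_schwarz)
    also have "\<dots> \<le> (norm q0 + B) * norm p"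
      using B[OF that] by (intro mult_right_mono) (auto simp: assms(5) intro: norm_triangle_le)
    finally show ?thesis
      using mult_left_mono[OF _ C0] by (fastforce simp: \<rho>_def)
  qed
  have "B \<ge> 0"
    using False B by (meson ex_in_conv norm_ge_zero order_trans)
  then have "\<rho> > 0"
    using C0 by (simp add: \<rho>_def add_nonneg_pos)
  moreover have "convex Y" "cone Y"
    using assms(4) by (auto simp: proper_cone_def)
  ultimately show ?thesis
    using bin p C0 C le
    by (intro exI[of _ \<rho>])
      (blast intro: order.antisym second_stage_loss_le_penalized_loss penalized_loss_le_second_stage_loss)
qed

end
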